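(* Let $X$ be a complex Banach space of dimension at least $2$, and let $\mathcal R$ be a property of operators satisfying conditions (a) and (b) below. Let $\mathcal S\subseteq\mathcal B(X)$ be a multiplicative semigroup each of whose members has property $\mathcal R$, and suppose $\operatorname{rank}[S,T]\le1$ for all $S,T\in\mathcal S$. Then $\mathcal S$ is triangularizable.
   Context: $\mathcal B(X)$ is the algebra of bounded linear operators on $X$; subspaces are closed linear subspaces; $[S,T]=ST-TS$. A subspace $\mathcal M$ is invariant under a collection $\mathcal C$ if $T(\mathcal M)\subseteq\mathcal M$ for all $T\in\mathcal C$. A collection $\mathcal C$ is triangularizable if there is a chain of subspaces invariant under $\mathcal C$ that is maximal as a chain of subspaces of $X$. If $\mathcal N\subset\mathcal M$ are invariant subspaces of $\mathcal C$, the quotient of $T\in\mathcal C$ is the operator $\hat T$ on $\mathcal M/\mathcal N$ given by $\hat T(x+\mathcal N)=Tx+\mathcal N$. $\mathcal R$ is a property of operators on complex Banach spaces of dimension at least $2$ such that: (a) $\mathcal R$ is inherited by quotients, i.e. if every operator in a collection $\mathcal C$ has $\mathcal R$, then for any invariant subspaces $\mathcal N\subset\mathcal M$ of $\mathcal C$ with $\dim(\mathcal M/\mathcal N)\ge 2$, every quotient $\hat T$ ($T\in\mathcal C$) on $\mathcal M/\mathcal N$ has $\mathcal R$; (b) every commutative semigroup of operators (on a space of dimension at least 2) all having property $\mathcal R$ has a non-trivial invariant subspace. *)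

theory Defs
  imports "HOL-Analysis.Analysis"
begin

text \<open>HOL has no class of complex vector spaces; we add one (as in the AFP entry
Complex_Bounded_Operators): a real vector space with a compatible complex scalar
multiplication.\<close>

class complex_vector = real_vector +
  fixes scaleC :: "complex \<Rightarrow> 'a \<Rightarrow> 'a" (infixr "*\<^sub>C" 75)
  assumes scaleC_add_right: "a *\<^sub>C (x + y) = a *\<^sub>C x + a *\<^sub>C y"
    and scaleC_add_left: "(a + b) *\<^sub>C x = a *\<^sub>C x + b *\<^sub>C x"
    and scaleC_scaleC: "a *\<^sub>C (b *\<^sub>C x) = (a * b) *\<^sub>C x"
    and scaleC_one: "1 *\<^sub>C x = x"
    and scaleR_scaleC: "scaleR r = scaleC (complex_of_real r)"

class complex_normed_vector = complex_vector + real_normed_vector +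
  assumes norm_scaleC: "norm (a *\<^sub>C x) = cmod a * norm x"

class complex_banach = complex_normed_vector + banach

definition clinear :: "('a::complex_vector \<Rightarrow> 'a) \<Rightarrow> bool" where
  "clinear f \<longleftrightarrow> (\<forall>x y. f (x + y) = f x + f y) \<and> (\<forall>c x. f (c *\<^sub>C x) = c *\<^sub>C f x)"

definition bounded_ops :: "('a::complex_normed_vector \<Rightarrow> 'a) set" where
  "bounded_ops = {T. clinear T \<and> (\<exists>K. \<forall>x. norm (T x) \<le> norm x * K)}"

definition csubspace :: "'a::complex_normed_vector set \<Rightarrow> bool" where
  "csubspace M \<longleftrightarrow> closed M \<and> 0 \<in> M \<and> (\<forall>x\<in>M. \<forall>y\<in>M. x + y \<in> M)
     \<and> (\<forall>c. \<forall>x\<in>M. c *\<^sub>C x \<in> M)"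

definition invariant_under :: "('a \<Rightarrow> 'a) set \<Rightarrow> 'a set \<Rightarrow> bool" where
  "invariant_under C M \<longleftrightarrow> (\<forall>T\<in>C. T ` M \<subseteq> M)"

text \<open>dim(M/N) \<ge> 2 (for subspaces N \<subseteq> M): there are two vectors of M whose classes
modulo N are linearly independent.  With N = {0}, M = X this says dim X \<ge> 2.\<close>
definition quot_dim_ge2 :: "'a::complex_vector set \<Rightarrow> 'a set \<Rightarrow> bool" where
  "quot_dim_ge2 M N \<longleftrightarrow> (\<exists>x\<in>M. \<exists>y\<in>M. \<forall>a b. a *\<^sub>C x + b *\<^sub>C y \<in> N \<longrightarrow> a = 0 \<and> b = 0)"

definition rank_le1 :: "('a::complex_vector \<Rightarrow> 'a) \<Rightarrow> bool" where
  "rank_le1 T \<longleftrightarrow> (\<exists>v. \<forall>x. \<exists>c. T x = c *\<^sub>C v)"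

definition commutator :: "('a::ab_group_add \<Rightarrow> 'a) \<Rightarrow> ('a \<Rightarrow> 'a) \<Rightarrow> 'a \<Rightarrow> 'a" where
  "commutator S T = (\<lambda>x. S (T x) - T (S x))"

definition is_semigroup :: "('a \<Rightarrow> 'a) set \<Rightarrow> bool" where
  "is_semigroup S \<longleftrightarrow> (\<forall>A\<in>S. \<forall>B\<in>S. A \<circ> B \<in> S)"

definition subspace_chain :: "'a::complex_normed_vector set set \<Rightarrow> bool" where
  "subspace_chain \<C> \<longleftrightarrow> (\<forall>M\<in>\<C>. csubspace M) \<and> (\<forall>M\<in>\<C>. \<forall>N\<in>\<C>. M \<subseteq> N \<or> N \<subseteq> M)"

definition maximal_subspace_chain :: "'a::complex_normed_vector set set \<Rightarrow> bool" where
  "maximal_subspace_chain \<C> \<longleftrightarrow> subspace_chain \<C> \<and>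
     (\<forall>\<D>. subspace_chain \<D> \<and> \<C> \<subseteq> \<D> \<longrightarrow> \<D> = \<C>)"

definition triangularizable :: "('a::complex_normed_vector \<Rightarrow> 'a) set \<Rightarrow> bool" where
  "triangularizable C \<longleftrightarrow> (\<exists>\<C>. maximal_subspace_chain \<C> \<and> (\<forall>M\<in>\<C>. invariant_under C M))"

text \<open>The property R is encoded on the quotients that occur: R M N T means
"the quotient operator T^ on M/N has property R" (N \<subseteq> M invariant subspaces of T).
In particular R UNIV {0} T means that T itself has R.\<close>

definition quotient_well_defined ::
  "('a::complex_normed_vector set \<Rightarrow> 'a set \<Rightarrow> ('a \<Rightarrow> 'a) \<Rightarrow> bool) \<Rightarrow> bool" where
  "quotient_well_defined R \<longleftrightarrow>
    (\<forall>M N T T'. csubspace M \<and> csubspace N \<and> N \<subseteq> M \<and> T \<in> bounded_ops \<and> T' \<in> bounded_ops \<and>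
        invariant_under {T, T'} M \<and> invariant_under {T, T'} N \<and>
        (\<forall>x\<in>M. T x - T' x \<in> N) \<longrightarrow> (R M N T \<longleftrightarrow> R M N T'))"

definition inherited_by_quotients ::
  "('a::complex_normed_vector set \<Rightarrow> 'a set \<Rightarrow> ('a \<Rightarrow> 'a) \<Rightarrow> bool) \<Rightarrow> bool" where
  "inherited_by_quotients R \<longleftrightarrow>
    (\<forall>C M N. C \<subseteq> bounded_ops \<and> (\<forall>T\<in>C. R UNIV {0} T) \<and>
        csubspace M \<and> csubspace N \<and> N \<subset> M \<and> invariant_under C M \<and> invariant_under C N \<and>
        quot_dim_ge2 M N \<longrightarrow> (\<forall>T\<in>C. R M N T))"

text \<open>Condition (b), on every quotient space M/N of X (of dimension \<ge> 2, including X
itself): every commutative semigroup of operators on M/N (given as quotients of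
operators in B(X)) all having R has a non-trivial invariant subspace, i.e. a closed
subspace L with N \<subset> L \<subset> M invariant under the operators.\<close>
definition commutative_reducible ::
  "('a::complex_normed_vector set \<Rightarrow> 'a set \<Rightarrow> ('a \<Rightarrow> 'a) \<Rightarrow> bool) \<Rightarrow> bool" where
  "commutative_reducible R \<longleftrightarrow>
    (\<forall>C M N. C \<subseteq> bounded_ops \<and>
        csubspace M \<and> csubspace N \<and> N \<subset> M \<and> invariant_under C M \<and> invariant_under C N \<and>
        quot_dim_ge2 M N \<and>
        (\<forall>A\<in>C. \<forall>B\<in>C. \<exists>D\<in>C. \<forall>x\<in>M. A (B x) - D x \<in> N) \<and>
        (\<forall>A\<in>C. \<forall>B\<in>C. \<forall>x\<in>M. A (B x) - B (A x) \<in> N) \<and>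
        (\<forall>T\<in>C. R M N T)
      \<longrightarrow> (\<exists>L. csubspace L \<and> N \<subset> L \<and> L \<subset> M \<and> invariant_under C L))"

end

theory Submission
  imports Defs
begin

text \<open>A commutator of rank one in the semigroup has the form \<open>F x = f x *\<^sub>C u\<close>.  Since the commutators
\<open>[A, B\<^sup>2]\<close>, \<open>[A\<^sup>2, B]\<close> and \<open>[A\<^sup>2, B\<^sup>2]\<close> have rank at most one as well, \<open>u\<close> or \<open>f\<close> is an eigenvector
of \<open>A\<close> and of \<open>B\<close> (or of their adjoints), and this forces \<open>f u = 0\<close>: every commutator has square
zero, as if traces were available.  Expanding the six commutators of one of \<open>A\<close>, \<open>B\<close>, \<open>C\<close> with
a product of the other two then yields \<open>f (C u) = 0\<close>, that is \<open>F C F = 0\<close> for all \<open>C\<close> in the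
semigroup.  Hence, if \<open>F\<close> does not vanish on \<open>M/N\<close>, the vectors \<open>x \<in> M\<close> with \<open>F x \<in> N\<close> and
\<open>F (C x) \<in> N\<close> for all \<open>C\<close> form an invariant subspace strictly between \<open>N\<close> and \<open>M\<close>.  If all
commutators vanish on \<open>M/N\<close>, condition (b) provides such a subspace.  A maximal chain of
invariant subspaces therefore has no gap of dimension two or more, so it is maximal
among all chains of subspaces.\<close>

section \<open>Complex-linear maps, linear forms and commutator identities\<close>

global_interpretation complex_vector: vector_space "scaleC :: complex \<Rightarrow> 'a::complex_vector \<Rightarrow> 'a"
  by unfold_locales (simp_all add: scaleC_add_right scaleC_add_left scaleC_scaleC scaleC_one)

text \<open>Continuity is not demanded: forms serve only the algebra of rank-one maps, and
  closedness later comes from continuity of the operators.\<close>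

definition clinear_form :: "('a::complex_vector \<Rightarrow> complex) \<Rightarrow> bool" where
  "clinear_form f \<longleftrightarrow> (\<forall>x y. f (x + y) = f x + f y) \<and> (\<forall>c x. f (c *\<^sub>C x) = c * f x)"

lemma clinear_form_add: "clinear_form f \<Longrightarrow> f (x + y) = f x + f y"
  and clinear_form_scale: "clinear_form f \<Longrightarrow> f (c *\<^sub>C x) = c * f x"
  by (simp_all add: clinear_form_def)

lemma clinear_form_zero: "clinear_form f \<Longrightarrow> f 0 = 0"
  using clinear_form_scale[of f 0 0] by simp

lemma clinear_form_diff: "clinear_form f \<Longrightarrow> f (x - y) = f x - f y"
  using clinear_form_add[of f "x - y" y] by simp

lemma clinear_add: "clinear T \<Longrightarrow> T (x + y) = T x + T y"
  and clinear_scale: "clinear T \<Longrightarrow> T (c *\<^sub>C x) = c *\<^sub>C T x"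
  by (simp_all add: clinear_def)

lemma clinear_zero: "clinear T \<Longrightarrow> T 0 = 0"
  using clinear_scale[of T 0 0] by simp

lemma clinear_diff: "clinear T \<Longrightarrow> T (x - y) = T x - T y"
  using clinear_add[of T "x - y" y] by simp

lemma clinear_minus: "clinear T \<Longrightarrow> T (- x) = - T x"
  using clinear_scale[of T "-1" x] by simp

lemma clinear_commutator: "clinear S \<Longrightarrow> clinear T \<Longrightarrow> clinear (commutator S T)"
  by (simp add: clinear_def commutator_def complex_vector.scale_right_diff_distrib)

lemma commutator_compose_right:
  "clinear B \<Longrightarrow> commutator A (B \<circ> C) x = commutator A B (C x) + B (commutator A C x)"
  by (simp add: commutator_def clinear_diff)

lemma commutator_compose_left:
  "clinear A \<Longrightarrow> commutator (A \<circ> B) C x = commutator A C (B x) + A (commutator B C x)"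
  by (simp add: commutator_def clinear_diff)

lemma commutator_swap: "commutator B A x = - commutator A B x"
  by (simp add: commutator_def)

section \<open>Operators of rank at most one\<close>

text \<open>For nonzero \<open>T\<close> the spanning vector is nonzero, so coefficients are unique
  and inherit linearity.\<close>

lemma rank_le1_decompose:
  assumes "clinear T" "rank_le1 T"
  shows "\<exists>f u. clinear_form f \<and> (\<forall>x. T x = f x *\<^sub>C u)"
proof (cases "\<forall>x. T x = 0")
  case True
  then show ?thesis by (intro exI[of _ "\<lambda>x. 0"] exI[of _ 0]) (simp add: clinear_form_def)
next
  case False
  obtain u where u: "\<forall>x. \<exists>c. T x = c *\<^sub>C u" using assms(2) by (auto simp: rank_le1_def)
  then have u0: "u \<noteq> 0" using False by force
  obtain f where f: "\<And>x. T x = f x *\<^sub>C u" using u by metis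
  have "f (x + y) *\<^sub>C u = (f x + f y) *\<^sub>C u" for x y
    using clinear_add[OF assms(1), of x y] by (simp add: f scaleC_add_left)
  moreover have "f (c *\<^sub>C x) *\<^sub>C u = (c * f x) *\<^sub>C u" for c x
    using clinear_scale[OF assms(1), of c x] by (simp add: f)
  ultimately have "clinear_form f" using u0 by (simp add: clinear_form_def)
  then show ?thesis using f by blast
qed

lemma scaleC_eq_scaleC_imp:
  assumes "c *\<^sub>C x = d *\<^sub>C y" "c \<noteq> 0"
  shows "x = (d / c) *\<^sub>C y"
proof -
  have "inverse c *\<^sub>C c *\<^sub>C x = inverse c *\<^sub>C d *\<^sub>C y" using assms(1) by simp
  then show ?thesis using assms(2) by (simp add: divide_inverse mult.commute)
qed

text \<open>If the coefficient functions are not proportional, two values of \<open>T\<close> have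
  independent coefficient pairs. Both values lie on one line, which forces a relation between
  \<open>p\<close> and \<open>q\<close>.\<close>

lemma rank_le1_sum_of_two:
  assumes r: "rank_le1 T" and T: "\<And>x. T x = \<phi> x *\<^sub>C p + \<psi> x *\<^sub>C q"
    and p: "p \<noteq> 0" and \<psi>: "\<psi> y \<noteq> 0"
  shows "(\<exists>c. q = c *\<^sub>C p) \<or> (\<exists>c. \<forall>x. \<phi> x = c * \<psi> x)"
proof (rule disjCI)
  assume "\<not> (\<exists>c. \<forall>x. \<phi> x = c * \<psi> x)"
  \<comment> \<open>Since \<open>\<psi> y\<close> is nonzero, \<open>\<phi> y / \<psi> y\<close> is
    the only possible factor; \<open>x\<close> violates proportionality with it.\<close>
  then obtain x where x: "\<phi> x \<noteq> (\<phi> y / \<psi> y) * \<psi> x" by blast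
  obtain v where "\<forall>x. \<exists>c. T x = c *\<^sub>C v" using r by (auto simp: rank_le1_def)
  then obtain a b where a: "T x = a *\<^sub>C v" and b: "T y = b *\<^sub>C v" by metis
  have "b *\<^sub>C T x = a *\<^sub>C T y" by (simp add: a b mult.commute)
  then have e: "(b * \<phi> x - a * \<phi> y) *\<^sub>C p + (b * \<psi> x - a * \<psi> y) *\<^sub>C q = 0"
    by (simp add: T scaleC_add_right complex_vector.scale_left_diff_distrib algebra_simps)
  show "\<exists>c. q = c *\<^sub>C p"
  proof (cases "b * \<psi> x - a * \<psi> y = 0")
    case False
    have "(b * \<psi> x - a * \<psi> y) *\<^sub>C q = (- (b * \<phi> x - a * \<phi> y)) *\<^sub>C p"
      using e by (metis add.inverse_unique complex_vector.scale_minus_left)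
    then show ?thesis using False scaleC_eq_scaleC_imp by blast
  next
    case True
    then have "b * \<phi> x - a * \<phi> y = 0" using e p by simp
    moreover have "a = b * \<psi> x / \<psi> y" using True \<psi> by (simp add: field_simps)
    ultimately have "b * (\<phi> x - (\<phi> y / \<psi> y) * \<psi> x) = 0" by (simp add: algebra_simps)
    \<comment> \<open>Thus \<open>T y = 0\<close>, and this value itself is a relation with nonzero
      coefficient at \<open>q\<close>.\<close>
    then have "b = 0" using x by simp
    then have "\<psi> y *\<^sub>C q = (- \<phi> y) *\<^sub>C p" using b T[of y]
      by (metis add.inverse_unique add.commute complex_vector.scale_minus_left complex_vector.scale_zero_left)
    then show ?thesis using \<psi> scaleC_eq_scaleC_imp by blast
  qed
qed

section \<open>Commutators have square zero\<close>

text \<open>The mixed case, with an eigenvector for \<open>B\<close> and an eigenform for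
  \<open>A\<close>. The rank condition on the commutator of the squares makes \<open>u\<close> an
  eigenvector of \<open>A\<close> too, or \<open>f\<close> an eigenform of \<open>B\<close> too;
  either way the commutator formula contradicts \<open>f u \<noteq> 0\<close>.\<close>

lemma rank_one_commutator_trace_aux:
  assumes A: "clinear A" and B: "clinear B" and f: "clinear_form f"
    and F: "\<And>x. commutator A B x = f x *\<^sub>C u"
    and r: "rank_le1 (commutator (A \<circ> A) (B \<circ> B))"
    and Bu: "B u = l *\<^sub>C u" and fA: "\<And>x. f (A x) = m * f x"
  shows "f u = 0"
proof (rule ccontr)
  assume fu: "f u \<noteq> 0"
  then have u: "u \<noteq> 0" using clinear_form_zero[OF f] by auto
  have fF: "f (A (B x)) - f (B (A x)) = f x * f u" for x
    using F[of x] by (metis f clinear_form_diff clinear_form_scale commutator_def)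
  define \<psi> where "\<psi> x = l * f x + f (B x)" for x
  have G: "commutator A (B \<circ> B) x = \<psi> x *\<^sub>C u" for x
    by (simp add: commutator_compose_right B clinear_scale F Bu \<psi>_def scaleC_add_left algebra_simps)
  have E: "commutator (A \<circ> A) (B \<circ> B) x = \<psi> (A x) *\<^sub>C u + \<psi> x *\<^sub>C A u" for x
    by (simp add: commutator_compose_left A clinear_scale G)
  have \<psi>A: "\<psi> (A x) = m * \<psi> x - f u * f x" for x
    using fF[of x] by (simp add: \<psi>_def fA algebra_simps)
  have noB: False if "\<And>x. f (B x) = c * f x" for c
    using fF[of u] fu by (simp add: fA that)
  have "\<exists>y. \<psi> y \<noteq> 0"
    using noB[of "-l"] by (auto simp: \<psi>_def add_eq_0_iff)
  then obtain y where "\<psi> y \<noteq> 0" ..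
  from rank_le1_sum_of_two[OF r E u this] show False
  proof (elim disjE exE)
    fix c assume "A u = c *\<^sub>C u"
    then have "commutator A B u = 0" by (simp add: commutator_def A B clinear_scale Bu mult.commute)
    then show False using F[of u] fu u by simp
  next
    fix c assume "\<forall>x. \<psi> (A x) = c * \<psi> x"
    \<comment> \<open>Two expressions for \<open>\<psi> (A x)\<close> are compared:
      \<open>\<psi>\<close> becomes a multiple of \<open>f\<close>, hence so does \<open>f\<close>
      composed with \<open>B\<close>.\<close>
    then have c: "(m - c) * \<psi> x = f u * f x" for x using \<psi>A[of x] by (simp add: algebra_simps)
    have "m - c \<noteq> 0" using c[of u] fu by auto
    then have "\<psi> x = f u * f x / (m - c)" for x using c[of x] by (simp add: field_simps)
    then have "f (B x) = (f u / (m - c) - l) * f x" for x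
      by (simp add: \<psi>_def algebra_simps add_eq_0_iff eq_diff_eq)
    then show False using noB by blast
  qed
qed

text \<open>One square at a time shows, for each of \<open>A\<close> and \<open>B\<close>, that
  \<open>u\<close> is an eigenvector or \<open>f\<close> an eigenform. If both operators fall under
  the same alternative, evaluation at \<open>u\<close> gives a contradiction; the mixed cases need
  both squares.\<close>

lemma rank_one_commutator_trace:
  assumes A: "clinear A" and B: "clinear B" and f: "clinear_form f"
    and F: "\<And>x. commutator A B x = f x *\<^sub>C u"
    and r21: "rank_le1 (commutator (A \<circ> A) B)" and r12: "rank_le1 (commutator A (B \<circ> B))"
    and r22: "rank_le1 (commutator (A \<circ> A) (B \<circ> B))"
  shows "f u = 0"
proof (rule ccontr)
  assume fu: "f u \<noteq> 0"
  then have u: "u \<noteq> 0" using clinear_form_zero[OF f] by auto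
  have "commutator (A \<circ> A) B x = f (A x) *\<^sub>C u + f x *\<^sub>C A u" for x
    by (simp add: commutator_compose_left A clinear_scale F)
  from rank_le1_sum_of_two[OF r21 this u fu]
  have a: "(\<exists>c. A u = c *\<^sub>C u) \<or> (\<exists>c. \<forall>x. f (A x) = c * f x)" .
  have "commutator A (B \<circ> B) x = f (B x) *\<^sub>C u + f x *\<^sub>C B u" for x
    by (simp add: commutator_compose_right B clinear_scale F)
  from rank_le1_sum_of_two[OF r12 this u fu]
  have b: "(\<exists>c. B u = c *\<^sub>C u) \<or> (\<exists>c. \<forall>x. f (B x) = c * f x)" .
  \<comment> \<open>The sign from exchanging \<open>A\<close> and \<open>B\<close> is put into the
    vector, so that the mixed case applies with the roles reversed.\<close>
  have F': "commutator B A x = f x *\<^sub>C (- u)" for x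
    using F[of x] by (simp add: commutator_swap[of B A])
  have r22': "rank_le1 (commutator (B \<circ> B) (A \<circ> A))"
    using r22 unfolding rank_le1_def commutator_swap[of "B \<circ> B"]
    by (metis complex_vector.scale_minus_left)
  have fF: "f (A (B x)) - f (B (A x)) = f x * f u" for x
    using F[of x] by (metis f clinear_form_diff clinear_form_scale commutator_def)
  have neg: "B (- u) = - B u" "A (- u) = - A u" "f (- u) = - f u"
    using clinear_scale[OF B, of "-1" u] clinear_scale[OF A, of "-1" u] clinear_form_scale[OF f, of "-1" u]
    by simp_all
  from a b show False
  proof (elim disjE exE)
    fix c d assume "A u = c *\<^sub>C u" "B u = d *\<^sub>C u"
    then have "commutator A B u = 0" by (simp add: commutator_def A B clinear_scale mult.commute)
    then show False using F[of u] fu u by simp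
  next
    fix c d assume "\<forall>x. f (A x) = c * f x" "\<forall>x. f (B x) = d * f x"
    then show False using fF[of u] fu by simp
  next
    fix c d assume "\<forall>x. f (A x) = c * f x" "B u = d *\<^sub>C u"
    then show False using rank_one_commutator_trace_aux[OF A B f F r22] fu by blast
  next
    fix c d assume "A u = c *\<^sub>C u" "\<forall>x. f (B x) = d * f x"
    then show False
      using rank_one_commutator_trace_aux[OF B A f F' r22', of c d] fu by (simp add: neg)
  qed
qed

lemma commutator_square_zero:
  assumes A: "clinear A" and B: "clinear B" and "rank_le1 (commutator A B)"
    and "rank_le1 (commutator (A \<circ> A) B)" "rank_le1 (commutator A (B \<circ> B))"
    and "rank_le1 (commutator (A \<circ> A) (B \<circ> B))"
  shows "commutator A B (commutator A B x) = 0"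
proof -
  obtain f u where f: "clinear_form f" and F: "\<And>x. commutator A B x = f x *\<^sub>C u"
    using rank_le1_decompose[OF clinear_commutator[OF A B] assms(3)] by blast
  have "f u = 0" using rank_one_commutator_trace[OF A B f F assms(4-6)] .
  then show ?thesis by (simp add: F f clinear_form_scale)
qed

text \<open>The sum is the trace of \<open>T\<close>. Proportional vectors or forms let the two
  terms merge into a single one, \<open>\<theta> x *\<^sub>C z\<close>, and then square zero forces
  \<open>\<theta> z = 0\<close>.\<close>

lemma square_zero_imp_trace_zero:
  assumes r: "rank_le1 T" and T: "\<And>x. T x = \<phi> x *\<^sub>C p + \<psi> x *\<^sub>C q" and TT: "\<And>x. T (T x) = 0"
    and \<phi>: "clinear_form \<phi>" and \<psi>: "clinear_form \<psi>"
  shows "\<phi> p + \<psi> q = 0"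
proof -
  note lin = clinear_form_add clinear_form_scale clinear_form_zero
  have one: "\<theta> z = 0" if "clinear_form \<theta>" "\<And>x. T x = \<theta> x *\<^sub>C z" for \<theta> z
    using TT[of z] that by (auto simp: lin)
  consider "p = 0" | "\<forall>x. \<psi> x = 0" | "p \<noteq> 0" "\<exists>y. \<psi> y \<noteq> 0" by blast
  then show ?thesis
  proof cases
    case 1
    then show ?thesis using one[of \<psi> q] \<phi> \<psi> T by (simp add: lin)
  next
    case 2
    then show ?thesis using one[of \<phi> p] \<phi> T by simp
  next
    case 3
    then obtain y where "\<psi> y \<noteq> 0" by blast
    from rank_le1_sum_of_two[OF r T 3(1) this] show ?thesis
    proof (elim disjE exE)
      fix c assume c: "q = c *\<^sub>C p"
      have "clinear_form (\<lambda>x. \<phi> x + c * \<psi> x)"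
        using \<phi> \<psi> by (simp add: clinear_form_def algebra_simps)
      from one[OF this, of p] show ?thesis
        by (simp add: T c \<psi> lin scaleC_add_left mult.commute)
    next
      fix c assume c: "\<forall>x. \<phi> x = c * \<psi> x"
      show ?thesis using one[OF \<psi>, of "c *\<^sub>C p + q"]
        by (simp add: T c \<psi> lin scaleC_add_right mult.commute)
    qed
  qed
qed


section \<open>Products of a commutator, a semigroup element and the same commutator\<close>

text \<open>Proportionality is weakened to equality of zero sets. Without scalar factors the
  relations become equivalences that can be chained by propositional reasoning.\<close>

lemma rank_le1_sum_of_two_zeros:
  assumes r: "rank_le1 T" and T: "\<And>x. T x = \<phi> x *\<^sub>C p + \<psi> x *\<^sub>C q"
    and p: "p \<noteq> 0" and q: "q \<noteq> 0" and \<phi>: "\<phi> z \<noteq> 0" and \<psi>: "\<psi> y \<noteq> 0"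
  shows "(\<forall>\<theta>. clinear_form \<theta> \<longrightarrow> (\<theta> p = 0 \<longleftrightarrow> \<theta> q = 0)) \<or> (\<forall>x. \<phi> x = 0 \<longleftrightarrow> \<psi> x = 0)"
  using rank_le1_sum_of_two[OF r T p \<psi>]
proof (elim disjE exE)
  fix c assume c: "q = c *\<^sub>C p"
  then have "c \<noteq> 0" using q by auto
  then show ?thesis by (simp add: c clinear_form_scale)
next
  fix c assume c: "\<forall>x. \<phi> x = c * \<psi> x"
  then have "c \<noteq> 0" using \<phi> by auto
  then show ?thesis by (simp add: c)
qed

lemma commutator_jacobi:
  assumes "clinear A" "clinear B" "clinear C"
  shows "A (commutator B C x) - commutator B C (A x) - B (commutator A C x) + commutator A C (B x)
    + C (commutator A B x) - commutator A B (C x) = 0"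
  using assms by (simp add: commutator_def clinear_diff)

text \<open>With the commutator written as \<open>f x *\<^sub>C u\<close>, the left side is a
  multiple of \<open>f (C u)\<close>, so it suffices that this number vanishes.\<close>

lemma commutator_sandwich_zero:
  assumes lin: "\<And>T. T \<in> S \<Longrightarrow> clinear T" and sg: "is_semigroup S"
    and rank: "\<And>P Q. P \<in> S \<Longrightarrow> Q \<in> S \<Longrightarrow> rank_le1 (commutator P Q)"
    and A: "A \<in> S" and B: "B \<in> S" and C: "C \<in> S"
  shows "commutator A B (C (commutator A B x)) = 0"
proof -
  have mult: "P \<circ> Q \<in> S" if "P \<in> S" "Q \<in> S" for P Q
    using sg that by (auto simp: is_semigroup_def)
  have nil: "commutator P Q (commutator P Q x) = 0" if "P \<in> S" "Q \<in> S" for P Q x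
    using that by (intro commutator_square_zero lin rank mult)
  note lA = lin[OF A] and lB = lin[OF B] and lC = lin[OF C]
  obtain f u where f: "clinear_form f" and AB: "\<And>x. commutator A B x = f x *\<^sub>C u"
    using rank_le1_decompose[OF clinear_commutator[OF lA lB] rank[OF A B]] by blast
  obtain g v where g: "clinear_form g" and AC: "\<And>x. commutator A C x = g x *\<^sub>C v"
    using rank_le1_decompose[OF clinear_commutator[OF lA lC] rank[OF A C]] by blast
  obtain h w where h: "clinear_form h" and BC: "\<And>x. commutator B C x = h x *\<^sub>C w"
    using rank_le1_decompose[OF clinear_commutator[OF lB lC] rank[OF B C]] by blast
  have BA: "commutator B A x = (- f x) *\<^sub>C u" and CA: "commutator C A x = (- g x) *\<^sub>C v"
    and CB: "commutator C B x = (- h x) *\<^sub>C w" for x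
    using AB[of x] AC[of x] BC[of x]
    by (simp_all add: commutator_swap[of B A] commutator_swap[of C A] commutator_swap[of C B])
  note forms = f g h
  have neg: "clinear_form (\<lambda>x. - \<phi> x)" if "clinear_form \<phi>" for \<phi> :: "'a \<Rightarrow> complex"
    using that by (simp add: clinear_form_def)
  have comp: "clinear_form (\<lambda>x. \<phi> (T x))" if "clinear_form \<phi>" "clinear T" for \<phi> T
    using that by (simp add: clinear_def clinear_form_def)
  note expand = commutator_compose_right lA lB lC clinear_scale clinear_minus AB AC BC BA CA CB
  have eBC: "commutator A (B \<circ> C) x = f (C x) *\<^sub>C u + g x *\<^sub>C B v" for x by (simp add: expand)
  have eCB: "commutator A (C \<circ> B) x = g (B x) *\<^sub>C v + f x *\<^sub>C C u" for x by (simp add: expand)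
  have eAC: "commutator B (A \<circ> C) x = (- f (C x)) *\<^sub>C u + h x *\<^sub>C A w" for x by (simp add: expand)
  have eCA: "commutator B (C \<circ> A) x = h (A x) *\<^sub>C w + (- f x) *\<^sub>C C u" for x by (simp add: expand)
  have eAB: "commutator C (A \<circ> B) x = (- g (B x)) *\<^sub>C v + (- h x) *\<^sub>C A w" for x by (simp add: expand)
  have eBA: "commutator C (B \<circ> A) x = (- h (A x)) *\<^sub>C w + (- g x) *\<^sub>C B v" for x by (simp add: expand)
  have fu: "f u = 0" and gv: "g v = 0" and hw: "h w = 0"
    using nil[OF A B, of u] nil[OF A C, of v] nil[OF B C, of w]
    by (auto simp: AB AC BC forms clinear_form_scale clinear_form_zero)
  \<comment> \<open>Each commutator with a product again has square zero, hence trace zero. So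
    \<open>f (C u)\<close>, \<open>- g (B v)\<close> and \<open>h (A w)\<close> coincide.\<close>
  have t1: "f (C u) + g (B v) = 0"
    using square_zero_imp_trace_zero[OF rank eBC nil] by (simp add: mult A B C comp forms lA lB lC)
  have t2: "- g (B v) - h (A w) = 0"
    using square_zero_imp_trace_zero[OF rank eAB nil] by (simp add: mult A B C comp neg forms lA lB lC)
  have "f (C u) = 0"
    \<comment> \<open>Otherwise each of the six expansions makes two vectors or two forms proportional.  The
      vectors \<open>u, B v, w, C u, v, A w\<close> form a hexagon with these relations as edges, as do the forms
      \<open>f C, g, h A, f, g B, h\<close>; vanishing of \<open>f u, g v, h w\<close> leaves only the two alternating
      patterns, which contradict the Jacobi identity.\<close>
  proof (rule ccontr)
    assume t: "f (C u) \<noteq> 0"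
    then have nz: "f (C u) \<noteq> 0" "g (B v) \<noteq> 0" "h (A w) \<noteq> 0" using t1 t2 by auto
    then have nz0: "u \<noteq> 0" "v \<noteq> 0" "w \<noteq> 0" "C u \<noteq> 0" "B v \<noteq> 0" "A w \<noteq> 0"
      using forms clinear_form_zero clinear_zero[OF lA] clinear_zero[OF lB] clinear_zero[OF lC] by metis+
    define same where "same p q \<longleftrightarrow> (\<forall>\<theta>. clinear_form \<theta> \<longrightarrow> (\<theta> p = 0 \<longleftrightarrow> \<theta> q = 0))" for p q :: 'a
    have a: "same u (B v) \<or> (\<forall>x. f (C x) = 0 \<longleftrightarrow> g x = 0)"
      using rank_le1_sum_of_two_zeros[OF rank eBC, where z = u and y = "B v"] nz nz0 unfolding same_def
      by (simp add: mult A B C)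
    have b: "same v (C u) \<or> (\<forall>x. g (B x) = 0 \<longleftrightarrow> f x = 0)"
      using rank_le1_sum_of_two_zeros[OF rank eCB, where z = v and y = "C u"] nz nz0 unfolding same_def
      by (simp add: mult A B C)
    have c: "same u (A w) \<or> (\<forall>x. f (C x) = 0 \<longleftrightarrow> h x = 0)"
      using rank_le1_sum_of_two_zeros[OF rank eAC, where z = u and y = "A w"] nz nz0 unfolding same_def
      by (simp add: mult A B C)
    have d: "same w (C u) \<or> (\<forall>x. h (A x) = 0 \<longleftrightarrow> f x = 0)"
      using rank_le1_sum_of_two_zeros[OF rank eCA, where z = w and y = "C u"] nz nz0 unfolding same_def
      by (simp add: mult A B C)
    have e: "same v (A w) \<or> (\<forall>x. g (B x) = 0 \<longleftrightarrow> h x = 0)"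
      using rank_le1_sum_of_two_zeros[OF rank eAB, where z = v and y = "A w"] nz nz0 unfolding same_def
      by (simp add: mult A B C)
    have k: "same w (B v) \<or> (\<forall>x. h (A x) = 0 \<longleftrightarrow> g x = 0)"
      using rank_le1_sum_of_two_zeros[OF rank eBA, where z = w and y = "B v"] nz nz0 unfolding same_def
      by (simp add: mult A B C)
    have jac: "h x *\<^sub>C A w - h (A x) *\<^sub>C w - g x *\<^sub>C B v + g (B x) *\<^sub>C v + f x *\<^sub>C C u - f (C x) *\<^sub>C u = 0"
      for x using commutator_jacobi[OF lA lB lC, of x] by (simp add: AB AC BC lA lB lC clinear_scale)
    \<comment> \<open>Evaluating at \<open>u\<close> and applying \<open>g\<close> removes the terms
      with \<open>f u\<close> or \<open>g v\<close>; the two multiples of \<open>g u\<close> cancel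
      by \<open>t1\<close>. Below, \<open>v\<close> and \<open>f\<close> play the same game.\<close>
    have "g (h u *\<^sub>C A w - h (A u) *\<^sub>C w - g u *\<^sub>C B v + g (B u) *\<^sub>C v + f u *\<^sub>C C u - f (C u) *\<^sub>C u) = 0"
      unfolding jac by (rule clinear_form_zero[OF g])
    then have "h u * g (A w) - h (A u) * g w - g u * (f (C u) + g (B v)) = 0"
      by (simp add: g clinear_form_add clinear_form_diff clinear_form_scale fu gv algebra_simps)
    then have j1: "h u * g (A w) = h (A u) * g w" by (simp add: t1)
    have "f (h v *\<^sub>C A w - h (A v) *\<^sub>C w - g v *\<^sub>C B v + g (B v) *\<^sub>C v + f v *\<^sub>C C u - f (C v) *\<^sub>C u) = 0"
      unfolding jac by (rule clinear_form_zero[OF f])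
    then have "h v * f (A w) - h (A v) * f w + f v * (f (C u) + g (B v)) = 0"
      by (simp add: f clinear_form_add clinear_form_diff clinear_form_scale fu gv algebra_simps)
    then have j2: "h v * f (A w) = h (A v) * f w" by (simp add: t1)
    have sf: "f p = 0 \<longleftrightarrow> f q = 0" and sg: "g p = 0 \<longleftrightarrow> g q = 0" and sh: "h p = 0 \<longleftrightarrow> h q = 0"
      if "same p q" for p q using that forms by (auto simp: same_def)
    let ?a = "\<forall>x. f (C x) = 0 \<longleftrightarrow> g x = 0" and ?b = "\<forall>x. g (B x) = 0 \<longleftrightarrow> f x = 0"
    let ?c = "\<forall>x. f (C x) = 0 \<longleftrightarrow> h x = 0" and ?d = "\<forall>x. h (A x) = 0 \<longleftrightarrow> f x = 0"
    let ?e = "\<forall>x. g (B x) = 0 \<longleftrightarrow> h x = 0" and ?k = "\<forall>x. h (A x) = 0 \<longleftrightarrow> g x = 0"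
    \<comment> \<open>In the first nine exclusions the relations carry a zero among
      \<open>f u\<close>, \<open>g v\<close>, \<open>h w\<close> to one of the nonzero numbers in
      \<open>nz\<close>.\<close>
    have "\<not> (same u (B v) \<and> same w (B v) \<and> same w (C u))" using sf fu nz by metis
    moreover have "\<not> (?b \<and> ?e \<and> ?c)" using fu nz by metis
    moreover have "\<not> (?e \<and> ?c \<and> ?a)" using gv nz by metis
    moreover have "\<not> (same u (B v) \<and> same w (B v) \<and> ?d)" using sf fu nz by metis
    moreover have "\<not> (same w (C u) \<and> same v (C u) \<and> ?e)" using sh hw nz by metis
    moreover have "\<not> (same v (A w) \<and> same u (A w) \<and> ?a)" using sg gv nz by metis
    moreover have "\<not> (?k \<and> ?d \<and> same v (C u))" using sf gv nz by metis
    moreover have "\<not> (?b \<and> ?e \<and> same u (A w))" using sh fu nz by metis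
    moreover have "\<not> (?c \<and> ?a \<and> same v (A w))" using sh gv nz by metis
    \<comment> \<open>Here \<open>g (A w) = 0\<close> because \<open>g v = 0\<close>, so
      \<open>j1\<close> requires \<open>h (A u) * g w = 0\<close>. But \<open>g u\<close> and
      \<open>h (A w)\<close> are nonzero, so \<open>?k\<close> makes both factors nonzero.\<close>
    moreover have "\<not> (same u (B v) \<and> same v (A w) \<and> ?k)"
      using j1 sg gv nz by (metis mult_eq_0_iff mult_zero_right)
    moreover have "\<not> (same u (A w) \<and> same v (C u) \<and> ?d)"
      using j2 sf fu nz by (metis mult_eq_0_iff mult_zero_right)
    ultimately show False using a b c d e k by argo
  qed
  then show ?thesis by (simp add: AB lC f clinear_scale clinear_form_scale)
qed

section \<open>Closed subspaces and reduction of noncommutative quotients\<close>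

lemma bounded_ops_clinear: "T \<in> bounded_ops \<Longrightarrow> clinear T"
  by (simp add: bounded_ops_def)

lemma bounded_ops_continuous:
  assumes "T \<in> bounded_ops"
  shows "continuous_on UNIV T"
proof -
  obtain K where "\<forall>x. norm (T x) \<le> norm x * K" using assms by (auto simp: bounded_ops_def)
  then have "bounded_linear T"
    using bounded_ops_clinear[OF assms]
    by (intro bounded_linear_intro[where K = K]) (auto simp: clinear_add clinear_scale scaleR_scaleC)
  then show ?thesis by (simp add: linear_continuous_on)
qed

lemma csubspaceI:
  assumes "closed M" "0 \<in> M" "\<And>x y. x \<in> M \<Longrightarrow> y \<in> M \<Longrightarrow> x + y \<in> M"
    "\<And>c x. x \<in> M \<Longrightarrow> c *\<^sub>C x \<in> M"
  shows "csubspace M"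
  using assms by (simp add: csubspace_def)

lemma
  assumes "csubspace M"
  shows csubspace_closed: "closed M" and csubspace_0: "0 \<in> M"
    and csubspace_add: "x \<in> M \<Longrightarrow> y \<in> M \<Longrightarrow> x + y \<in> M"
    and csubspace_scale: "x \<in> M \<Longrightarrow> c *\<^sub>C x \<in> M"
  using assms by (simp_all add: csubspace_def)

lemma csubspace_diff: "csubspace M \<Longrightarrow> x \<in> M \<Longrightarrow> y \<in> M \<Longrightarrow> x - y \<in> M"
  using csubspace_add[of M x "(-1) *\<^sub>C y"] csubspace_scale[of M y "-1"] by simp

lemma csubspace_scale_cancel:
  assumes "csubspace M" "c *\<^sub>C x \<in> M" "x \<notin> M"
  shows "c = 0"
proof (rule ccontr)
  assume "c \<noteq> 0"
  then have "inverse c *\<^sub>C c *\<^sub>C x = x" by simp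
  then show False using csubspace_scale[OF assms(1,2), of "inverse c"] assms(3) by simp
qed

lemma noncommuting_quotient_reducible:
  assumes S: "S \<subseteq> bounded_ops" and sg: "is_semigroup S"
    and rank: "\<And>P Q. P \<in> S \<Longrightarrow> Q \<in> S \<Longrightarrow> rank_le1 (commutator P Q)"
    and M: "csubspace M" "invariant_under S M" and N: "csubspace N" "invariant_under S N" "N \<subseteq> M"
    and A: "A \<in> S" and B: "B \<in> S" and x: "x \<in> M" "commutator A B x \<notin> N"
  shows "\<exists>L. csubspace L \<and> N \<subset> L \<and> L \<subset> M \<and> invariant_under S L"
proof -
  have lin: "clinear T" if "T \<in> S" for T using S that bounded_ops_clinear by blast
  have cont: "continuous_on UNIV T" if "T \<in> S" for T using S that bounded_ops_continuous by blast
  have mult: "P \<circ> Q \<in> S" if "P \<in> S" "Q \<in> S" for P Q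
    using sg that by (auto simp: is_semigroup_def)
  have SM: "T x \<in> M" if "T \<in> S" "x \<in> M" for T x using M(2) that by (auto simp: invariant_under_def)
  have SN: "T x \<in> N" if "T \<in> S" "x \<in> N" for T x using N(2) that by (auto simp: invariant_under_def)
  define F where "F = commutator A B"
  have F: "clinear F" by (simp add: F_def clinear_commutator lin A B)
  have Fcont: "continuous_on UNIV F"
    unfolding F_def commutator_def using cont[OF A] cont[OF B]
    by (intro continuous_intros) (auto intro: continuous_on_compose2)
  have FN: "F x \<in> N" if "x \<in> N" for x
    unfolding F_def commutator_def using that by (simp add: csubspace_diff N SN A B)
  have FM: "F x \<in> M" if "x \<in> M" for x
    unfolding F_def commutator_def using that by (simp add: csubspace_diff M SM A B)
  define L where "L = M \<inter> F -` N \<inter> (\<Inter>C\<in>S. (\<lambda>x. F (C x)) -` N)"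
  have "closed (F -` N)" "closed ((\<lambda>x. F (C x)) -` N)" if "C \<in> S" for C
    using Fcont csubspace_closed[OF N(1)] cont[OF that]
    by (auto intro!: closed_vimage intro: continuous_on_compose2)
  then have "closed L" unfolding L_def using csubspace_closed[OF M(1)] A by blast
  then have "csubspace L"
    by (rule csubspaceI)
      (auto simp: L_def F lin clinear_zero clinear_add clinear_scale csubspace_0 csubspace_add csubspace_scale M N)
  moreover have "invariant_under S L"
    unfolding invariant_under_def L_def using SM mult by fastforce
  moreover have "N \<subseteq> L" using N(3) FN SN by (auto simp: L_def)
  moreover have "F (F x) = 0"
    unfolding F_def using A B by (intro commutator_square_zero lin rank mult)
  then have "F x \<in> L" using FM[OF x(1)] csubspace_0[OF N(1)]
      commutator_sandwich_zero[OF lin sg rank A B]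
    by (auto simp: L_def F_def)
  moreover have "F x \<notin> N" "x \<notin> L" using x(2) by (auto simp: L_def F_def)
  moreover have "L \<subseteq> M" by (auto simp: L_def)
  ultimately show ?thesis using x(1) by blast
qed

section \<open>From reducible quotients to a maximal chain of subspaces\<close>

lemma csubspace_closure_chain_Union:
  assumes ch: "subspace_chain \<C>" and ne: "\<C> \<noteq> {}"
  shows "csubspace (closure (\<Union>\<C>))"
proof (rule csubspaceI)
  let ?U = "\<Union>\<C>"
  have sub: "csubspace M" if "M \<in> \<C>" for M using ch that by (simp add: subspace_chain_def)
  show "closed (closure ?U)" by simp
  obtain M where "M \<in> \<C>" using ne by blast
  then have "0 \<in> ?U" using csubspace_0[OF sub] by blast
  then show "0 \<in> closure ?U" using closure_subset by (rule subsetD[rotated])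
  have add: "x + y \<in> ?U" if "x \<in> ?U" "y \<in> ?U" for x y
  proof -
    obtain P Q where PQ: "P \<in> \<C>" "x \<in> P" "Q \<in> \<C>" "y \<in> Q" using \<open>x \<in> ?U\<close> \<open>y \<in> ?U\<close> by auto
    then have "P \<subseteq> Q \<or> Q \<subseteq> P" using ch by (simp add: subspace_chain_def)
    then show ?thesis using PQ csubspace_add[OF sub] by blast
  qed
  show "x + y \<in> closure ?U" if xy: "x \<in> closure ?U" "y \<in> closure ?U" for x y
  proof -
    obtain X Y where "\<forall>n. X n \<in> ?U" "X \<longlonglongrightarrow> x" "\<forall>n. Y n \<in> ?U" "Y \<longlonglongrightarrow> y"
      using xy unfolding closure_sequential by blast
    then have "\<forall>n. X n + Y n \<in> ?U" "(\<lambda>n. X n + Y n) \<longlonglongrightarrow> x + y"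
      using add by (auto intro: tendsto_add)
    then show ?thesis unfolding closure_sequential by (intro exI[of _ "\<lambda>n. X n + Y n"]) blast
  qed
  show "c *\<^sub>C x \<in> closure ?U" if "x \<in> closure ?U" for c x
  proof -
    have "(\<lambda>x. c *\<^sub>C x) \<in> bounded_ops"
      unfolding bounded_ops_def clinear_def
      by (auto simp: scaleC_add_right norm_scaleC mult.commute intro!: exI[of _ "cmod c"])
    then have "continuous_on (closure ?U) (\<lambda>x. c *\<^sub>C x)"
      using bounded_ops_continuous continuous_on_subset by blast
    moreover have "(\<lambda>x. c *\<^sub>C x) ` ?U \<subseteq> closure ?U"
      using sub csubspace_scale closure_subset[of ?U] by blast
    ultimately have "(\<lambda>x. c *\<^sub>C x) ` closure ?U \<subseteq> closure ?U"
      by (intro image_closure_subset) auto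
    then show ?thesis using that by blast
  qed
qed

lemma invariant_under_closure_Union:
  assumes "S \<subseteq> bounded_ops" "\<And>M. M \<in> \<C> \<Longrightarrow> invariant_under S M"
  shows "invariant_under S (closure (\<Union>\<C>))"
  unfolding invariant_under_def
proof
  fix T assume T: "T \<in> S"
  have "continuous_on (closure (\<Union>\<C>)) T"
    using assms(1) T bounded_ops_continuous continuous_on_subset by blast
  moreover have "T ` \<Union>\<C> \<subseteq> closure (\<Union>\<C>)"
    using assms(2) T closure_subset[of "\<Union>\<C>"] unfolding invariant_under_def by blast
  ultimately show "T ` closure (\<Union>\<C>) \<subseteq> closure (\<Union>\<C>)"
    by (intro image_closure_subset) auto
qed

text \<open>A subspace \<open>K\<close> that could be added to a maximal chain of invariant
  subspaces sits strictly inside a gap between two members \<open>N\<close> and \<open>M\<close>.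
  The gap has dimension at least two, and an invariant subspace within it contradicts
  maximality.\<close>

lemma triangularizable_if_quotients_reducible:
  assumes S: "S \<subseteq> bounded_ops"
    and red: "\<And>M N. \<lbrakk>csubspace M; csubspace N; N \<subset> M; invariant_under S M; invariant_under S N;
      quot_dim_ge2 M N\<rbrakk> \<Longrightarrow> \<exists>L. csubspace L \<and> N \<subset> L \<and> L \<subset> M \<and> invariant_under S L"
  shows "triangularizable S"
proof -
  define Inv where "Inv = {M. csubspace M \<and> invariant_under S M}"
  obtain \<C> where "subset.maxchain Inv \<C>" using subset.Hausdorff[of Inv] ..
  then have cI: "subset.chain Inv \<C>"
    and max: "\<And>\<D>. subset.chain Inv \<D> \<Longrightarrow> \<C> \<subseteq> \<D> \<Longrightarrow> \<D> = \<C>"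
    by (auto simp: subset.maxchain_def)
  then have C: "\<C> \<subseteq> Inv" and chain: "\<And>P Q. P \<in> \<C> \<Longrightarrow> Q \<in> \<C> \<Longrightarrow> P \<subseteq> Q \<or> Q \<subseteq> P"
    by (auto simp: subset_chain_def)
  \<comment> \<open>The form in which maximality is used: it also shows that the chain contains the
    limits \<open>N\<close> and \<open>M\<close>.\<close>
  have memI: "L \<in> \<C>" if "L \<in> Inv" "\<And>P. P \<in> \<C> \<Longrightarrow> P \<subseteq> L \<or> L \<subseteq> P" for L
  proof -
    have "insert L \<C> = \<C>"
      using cI that by (intro max) (auto simp: subset_chain_insert)
    then show ?thesis by blast
  qed
  have ops0: "T 0 = 0" if "T \<in> S" for T using S that bounded_ops_clinear clinear_zero by blast
  \<comment> \<open>This guarantees a member below every subspace, so the union defining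
    \<open>N\<close> is over a nonempty family.\<close>
  have "{0} \<in> \<C>"
  proof (rule memI)
    show "{0} \<in> Inv" by (auto simp: Inv_def invariant_under_def ops0 intro: csubspaceI)
    show "P \<subseteq> {0} \<or> {0} \<subseteq> P" if "P \<in> \<C>" for P using that C csubspace_0 by (auto simp: Inv_def)
  qed
  have sub: "csubspace P" "invariant_under S P" if "P \<in> \<C>" for P using that C by (auto simp: Inv_def)
  have ch: "subspace_chain \<C>" using sub chain by (simp add: subspace_chain_def)
  have "\<D> = \<C>" if D: "subspace_chain \<D>" "\<C> \<subseteq> \<D>" for \<D>
  proof (rule ccontr)
    assume "\<D> \<noteq> \<C>"
    then obtain K where K: "K \<in> \<D>" "K \<notin> \<C>" using D(2) by blast
    have Ks: "csubspace K" using D(1) K(1) by (simp add: subspace_chain_def)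
    have cmp: "P \<subseteq> K \<or> K \<subseteq> P" if "P \<in> \<C>" for P
      using D K(1) that unfolding subspace_chain_def by blast
    define N where "N = closure (\<Union>{P\<in>\<C>. P \<subseteq> K})"
    \<comment> \<open>If no member contains \<open>K\<close>, this intersection is the whole space,
      which is still a closed invariant subspace.\<close>
    define M where "M = \<Inter>{P\<in>\<C>. K \<subseteq> P}"
    have PN: "P \<subseteq> N" if "P \<in> \<C>" "P \<subseteq> K" for P
      using that closure_subset[of "\<Union>{P\<in>\<C>. P \<subseteq> K}"] unfolding N_def by blast
    have MP: "M \<subseteq> P" if "P \<in> \<C>" "K \<subseteq> P" for P using that unfolding M_def by blast
    have NK: "N \<subseteq> K" unfolding N_def using csubspace_closed[OF Ks] by (intro closure_minimal) auto
    have KM: "K \<subseteq> M" unfolding M_def by blast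
    have "subspace_chain {P\<in>\<C>. P \<subseteq> K}" using ch by (simp add: subspace_chain_def)
    moreover have "{P\<in>\<C>. P \<subseteq> K} \<noteq> {}" using \<open>{0} \<in> \<C>\<close> csubspace_0[OF Ks] by blast
    ultimately have "csubspace N" unfolding N_def by (rule csubspace_closure_chain_Union)
    moreover have "invariant_under S N"
      unfolding N_def using S sub(2) by (intro invariant_under_closure_Union) auto
    moreover have "P \<subseteq> N \<or> N \<subseteq> P" if "P \<in> \<C>" for P using cmp[OF that] PN[OF that] NK by blast
    ultimately have N: "N \<in> \<C>" by (intro memI) (simp add: Inv_def)
    have "csubspace M" unfolding M_def
      by (rule csubspaceI) (auto intro!: closed_Inter simp: sub csubspace_closed csubspace_0 csubspace_add csubspace_scale)
    moreover have "invariant_under S M"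
      unfolding M_def using sub(2) unfolding invariant_under_def by blast
    moreover have "P \<subseteq> M \<or> M \<subseteq> P" if "P \<in> \<C>" for P using cmp[OF that] MP[OF that] KM by blast
    ultimately have M: "M \<in> \<C>" by (intro memI) (simp add: Inv_def)
    have "N \<noteq> K" "M \<noteq> K" using N M K(2) by auto
    then obtain x y where x: "x \<in> K" "x \<notin> N" and y: "y \<in> M" "y \<notin> K" using NK KM by blast
    \<comment> \<open>Modulo \<open>K\<close> only the \<open>y\<close> term survives, which gives
      \<open>b = 0\<close>; then \<open>x \<notin> N\<close> gives \<open>a = 0\<close>.\<close>
    have "a = 0 \<and> b = 0" if ab: "a *\<^sub>C x + b *\<^sub>C y \<in> N" for a b
    proof -
      have "a *\<^sub>C x + b *\<^sub>C y - a *\<^sub>C x \<in> K"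
        using ab NK Ks x by (intro csubspace_diff csubspace_scale) auto
      then have "b *\<^sub>C y \<in> K" by simp
      then have b: "b = 0" using csubspace_scale_cancel[OF Ks] y(2) by blast
      then have "a *\<^sub>C x \<in> N" using ab by simp
      then show ?thesis using b csubspace_scale_cancel[OF sub(1)[OF N]] x(2) by blast
    qed
    then have "quot_dim_ge2 M N" unfolding quot_dim_ge2_def using x(1) y(1) KM by blast
    moreover have "N \<subset> M" using x KM NK by blast
    ultimately obtain L where L: "csubspace L" "N \<subset> L" "L \<subset> M" "invariant_under S L"
      using red[of M N] sub M N by blast
    have "P \<subseteq> L \<or> L \<subseteq> P" if "P \<in> \<C>" for P
      using cmp[OF that] PN[OF that] MP[OF that] L(2,3) by blast
    then have "L \<in> \<C>" using L(1,4) by (intro memI) (simp add: Inv_def)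
    \<comment> \<open>Every member lies below \<open>N\<close> or above \<open>M\<close>, whereas
      \<open>L\<close> is strictly between them.\<close>
    then show False using cmp[of L] PN MP L by blast
  qed
  then have "maximal_subspace_chain \<C>" using ch by (simp add: maximal_subspace_chain_def)
  then show ?thesis using sub by (auto simp: triangularizable_def)
qed

theorem mainTheorem3:
  fixes R :: "'a::complex_banach set \<Rightarrow> 'a set \<Rightarrow> ('a \<Rightarrow> 'a) \<Rightarrow> bool"
    and S :: "('a \<Rightarrow> 'a) set"
  assumes dimX: "quot_dim_ge2 (UNIV :: 'a set) {0}"
    and R_wd: "quotient_well_defined R"
    and R_a: "inherited_by_quotients R"
    and R_b: "commutative_reducible R"
    and S_ops: "S \<subseteq> bounded_ops"
    and S_semigroup: "is_semigroup S"
    and S_R: "\<forall>T\<in>S. R UNIV {0} T"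
    and S_rank: "\<forall>A\<in>S. \<forall>B\<in>S. rank_le1 (commutator A B)"
  shows "triangularizable S"
proof (rule triangularizable_if_quotients_reducible[OF S_ops])
  fix M N :: "'a set"
  assume MN: "csubspace M" "csubspace N" "N \<subset> M" "invariant_under S M" "invariant_under S N"
    "quot_dim_ge2 M N"
  show "\<exists>L. csubspace L \<and> N \<subset> L \<and> L \<subset> M \<and> invariant_under S L"
  proof (cases "\<forall>A\<in>S. \<forall>B\<in>S. \<forall>x\<in>M. commutator A B x \<in> N")
    case True
    \<comment> \<open>The quotients on \<open>M/N\<close> now commute, so conditions (a) and (b)
      apply to \<open>S\<close> itself.\<close>
    have "\<forall>T\<in>S. R M N T" using R_a S_ops S_R MN unfolding inherited_by_quotients_def by blast
    moreover have "\<forall>A\<in>S. \<forall>B\<in>S. \<exists>D\<in>S. \<forall>x\<in>M. A (B x) - D x \<in> N"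
      using S_semigroup csubspace_0[OF MN(2)] unfolding is_semigroup_def
      by (metis comp_apply diff_self)
    moreover have "\<forall>A\<in>S. \<forall>B\<in>S. \<forall>x\<in>M. A (B x) - B (A x) \<in> N"
      using True by (simp add: commutator_def)
    ultimately show ?thesis
      using S_ops MN by (intro R_b[unfolded commutative_reducible_def, rule_format, of S M N] conjI)
  next
    case False
    then obtain A B x where "A \<in> S" "B \<in> S" "x \<in> M" "commutator A B x \<notin> N" by blast
    then show ?thesis
      using MN S_rank by (intro noncommuting_quotient_reducible[OF S_ops S_semigroup]) auto
  qed
qed

end
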